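(* Let $\mathfrak m$ be an uncountable cardinal satisfying $\sup\{\mathfrak m^{\mathfrak n} : \mathfrak n<\mathfrak m\}=\mathfrak m$. Then the topological group $\mathrm{Iso}(\mathbb U)$ of isometries of the classical separable Urysohn space $\mathbb U$ is not isomorphic (as a topological group) to any topological subgroup of $\mathrm{Iso}(\mathbb U_{\mathfrak m})$. In particular, $\mathrm{Iso}(\mathbb U_{\mathfrak m})$ is not a universal topological group of weight $\mathfrak m$: not every Hausdorff topological group of weight $\le\mathfrak m$ is isomorphic to a topological subgroup of $\mathrm{Iso}(\mathbb U_{\mathfrak m})$.
   Context: For an infinite cardinal $\mathfrak m$ with $\sup\{\mathfrak m^{\mathfrak n}:\mathfrak n<\mathfrak m\}=\mathfrak m$, $\mathbb U_{\mathfrak m}$ denotes the Urysohn--Katětov space: the complete metric space of weight $\mathfrak m$, unique up to isometry (Katětov), which contains an isometric copy of every metric space of weight $\le\mathfrak m$ and is $<\mathfrak m$-homogeneous: every isometry between two metric subspaces of density $<\mathfrak m$ extends to a self-isometry of the whole space. It has the one-point extension property: call a $1$-Lipschitz function $f:Y\to\mathbb R$ on a metric space $Y$ a Katětov function if $d(x,y)\le f(x)+f(y)$ for all $x,y\in Y$; if $Y\subseteq\mathbb U_{\mathfrak m}$ has density $<\mathfrak m$ (for $\mathfrak m=\aleph_0$: $Y$ finite) and $f$ is a Katětov function on $Y$, then there is $z\in\mathbb U_{\mathfrak m}$ with $d(z,y)=f(y)$ for all $y\in Y$. The classical Urysohn space is $\mathbb U=\mathbb U_{\aleph_0}$. All isometry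 groups carry the topology of simple (pointwise) convergence on the underlying metric space; a neighbourhood basis at the identity consists of the sets $\{g : d(x_i,gx_i)<\varepsilon,\ i=1,\dots,n\}$ with $x_1,\dots,x_n$ points of the space and $\varepsilon>0$. The weight of a topological space is the smallest cardinality of a base; the density is the smallest cardinality of a dense subset. *)

theory Defs
  imports "HOL-Analysis.Analysis" "HOL-Algebra.Bij"
begin

unbundle cardinal_syntax

section \<open>Cardinals, weight, density\<close>

text \<open>Cardinals are cardinal orders (\<^const>\<open>Card_order\<close>). In the next definition it suffices to
  let the competing upper bound \<open>t\<close> range over the type of \<open>m\<close>, because every cardinal below \<open>m\<close>
  is the cardinality of a subset of that type.\<close>

definition is_cardinal_sup :: "'a rel set \<Rightarrow> 'c rel \<Rightarrow> bool" where
  "is_cardinal_sup S m \<longleftrightarrow>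
     (\<forall>s\<in>S. s \<le>o m) \<and>
     (\<forall>t :: 'c rel. Card_order t \<and> (\<forall>s\<in>S. s \<le>o t) \<longrightarrow> m \<le>o t)"

definition is_base :: "'a topology \<Rightarrow> 'a set set \<Rightarrow> bool" where
  "is_base X \<B> \<longleftrightarrow>
     (\<forall>V\<in>\<B>. openin X V) \<and>
     (\<forall>U x. openin X U \<and> x \<in> U \<longrightarrow> (\<exists>V\<in>\<B>. x \<in> V \<and> V \<subseteq> U))"

definition has_weight :: "'a topology \<Rightarrow> 'c rel \<Rightarrow> bool" where
  "has_weight X m \<longleftrightarrow> (\<exists>\<B>. is_base X \<B> \<and> |\<B>| =o m) \<and> (\<forall>\<B>. is_base X \<B> \<longrightarrow> m \<le>o |\<B>| )"

definition weight_le :: "'a topology \<Rightarrow> 'c rel \<Rightarrow> bool" where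
  "weight_le X m \<longleftrightarrow> (\<exists>\<B>. is_base X \<B> \<and> |\<B>| \<le>o m)"

text \<open>For \<open>m = natLeq\<close> and a metrizable space, density less than \<open>m\<close> means that the space is finite.\<close>

definition density_less :: "'a topology \<Rightarrow> 'c rel \<Rightarrow> bool" where
  "density_less X m \<longleftrightarrow> (\<exists>D. D \<subseteq> topspace X \<and> X closure_of D = topspace X \<and> |D| <o m)"

section \<open>Urysohn--Katetov spaces\<close>

definition isometry_onto ::
  "'a set \<Rightarrow> ('a \<Rightarrow> 'a \<Rightarrow> real) \<Rightarrow> 'b set \<Rightarrow> ('b \<Rightarrow> 'b \<Rightarrow> real) \<Rightarrow> ('a \<Rightarrow> 'b) \<Rightarrow> bool" where
  "isometry_onto M d N e f \<longleftrightarrow>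
     bij_betw f M N \<and> (\<forall>x\<in>M. \<forall>y\<in>M. e (f x) (f y) = d x y)"

text \<open>The clause on isometric copies quantifies over metric spaces \<open>(N, e)\<close> carried by sets of the
  same type as \<open>M\<close>. This covers all metric spaces of weight at most \<open>m\<close> (for infinite \<open>m\<close>): such a
  space has a dense subset of cardinality at most \<open>m\<close>, which has an isometric copy on a subset of
  this type, as \<open>M\<close> has weight \<open>m\<close> and so at least \<open>m\<close> points. The embedding of that copy into \<open>M\<close>
  then extends to the whole space because \<open>M\<close> is complete.\<close>

definition urysohn_katetov :: "'c rel \<Rightarrow> 'a set \<Rightarrow> ('a \<Rightarrow> 'a \<Rightarrow> real) \<Rightarrow> bool" where
  "urysohn_katetov m M d \<longleftrightarrow>
     Metric_space M d \<and>
     Metric_space.mcomplete M d \<and>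
     has_weight (Metric_space.mtopology M d) m \<and>
     (\<forall>(N :: 'a set) e. Metric_space N e \<and> weight_le (Metric_space.mtopology N e) m \<longrightarrow>
        (\<exists>f M'. M' \<subseteq> M \<and> isometry_onto N e M' d f)) \<and>
     (\<forall>A B f. A \<subseteq> M \<and> B \<subseteq> M \<and>
        density_less (subtopology (Metric_space.mtopology M d) A) m \<and>
        density_less (subtopology (Metric_space.mtopology M d) B) m \<and>
        isometry_onto A d B d f \<longrightarrow>
        (\<exists>g. isometry_onto M d M d g \<and> (\<forall>x\<in>A. g x = f x)))"

section \<open>Topological groups\<close>

definition iso_group :: "'a set \<Rightarrow> ('a \<Rightarrow> 'a \<Rightarrow> real) \<Rightarrow> ('a \<Rightarrow> 'a) monoid" where
  "iso_group M d = (BijGroup M)\<lparr>carrier := {g \<in> Bij M. isometry_onto M d M d g}\<rparr>"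

text \<open>The topology of pointwise convergence is the one induced from the product \<open>M\<^sup>M\<close>.\<close>

definition iso_topology :: "'a set \<Rightarrow> ('a \<Rightarrow> 'a \<Rightarrow> real) \<Rightarrow> ('a \<Rightarrow> 'a) topology" where
  "iso_topology M d =
     subtopology (product_topology (\<lambda>_. Metric_space.mtopology M d) M) (carrier (iso_group M d))"

definition topological_group :: "'g monoid \<Rightarrow> 'g topology \<Rightarrow> bool" where
  "topological_group G T \<longleftrightarrow>
     group G \<and> topspace T = carrier G \<and>
     continuous_map (prod_topology T T) T (\<lambda>(x, y). x \<otimes>\<^bsub>G\<^esub> y) \<and>
     continuous_map T T (\<lambda>x. inv\<^bsub>G\<^esub> x)"

definition embeds_as_topological_subgroup ::
  "'g monoid \<Rightarrow> 'g topology \<Rightarrow> 'h monoid \<Rightarrow> 'h topology \<Rightarrow> bool" where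
  "embeds_as_topological_subgroup G S H T \<longleftrightarrow>
     (\<exists>K h. subgroup K H \<and> h \<in> iso G (H\<lparr>carrier := K\<rparr>) \<and>
            homeomorphic_map S (subtopology T K) h)"

text \<open>Groups on subsets of the type \<^typ>\<open>'c set\<close> represent all Hausdorff topological groups of weight
  at most \<open>m\<close> up to isomorphism: sending a point to the set of basic open sets containing it shows
  that such a group has at most \<open>2\<^sup>m\<close> elements, and \<^typ>\<open>'c\<close> has at least \<open>m\<close> elements.\<close>

definition contains_all_groups_of_weight_le :: "'c rel \<Rightarrow> 'h monoid \<Rightarrow> 'h topology \<Rightarrow> bool" where
  "contains_all_groups_of_weight_le m H T \<longleftrightarrow>
     (\<forall>(G :: 'c set monoid) S.
        topological_group G S \<and> Hausdorff_space S \<and> weight_le S m \<longrightarrow>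
        embeds_as_topological_subgroup G S H T)"

end

theory Submission
  imports Defs "HOL-Library.Countable_Set_Type" "HOL-Combinatorics.Transposition"
begin

text \<open>For uncountable \<open>m\<close> the space \<open>U\<^sub>m\<close> realises Katetov functions on countable sets. This forces a
  sequence of isometries that converges pointwise to the identity to converge uniformly on bounded
  sets. Hence a group embeds in \<open>Iso(U\<^sub>m)\<close> only if conjugates of a null sequence by a coarsely bounded
  sequence form a null sequence. \<open>Iso(U)\<close> violates this: conjugators \<open>v n \<circ> f\<close> with \<open>f\<close> fixed and
  \<open>v n\<close> in the stabiliser of a given finite set carry \<open>p\<close> to points \<open>y n\<close> that are moved by distance 1
  by isometries fixing more and more of a dense sequence. The permutation group of the natural
  numbers, with transpositions in place of these isometries, violates it in the same way and has
  countable weight.\<close>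

section \<open>Katetov functions on countable sets\<close>

lemma isometry_ontoD:
  assumes "isometry_onto M d M d g"
  shows "x \<in> M \<Longrightarrow> g x \<in> M" "x \<in> M \<Longrightarrow> y \<in> M \<Longrightarrow> d (g x) (g y) = d x y"
  using assms unfolding isometry_onto_def bij_betw_def by auto

lemma countable_imp_card_less:
  assumes "natLeq <o m" "countable Y"
  shows "|Y| <o m"
  using assms countable_card_le_natLeq ordLeq_ordLess_trans by blast

lemma natLeq_not_ordLeq_finite: "finite B \<Longrightarrow> \<not> natLeq \<le>o |B|"
  using infinite_iff_natLeq_ordLeq by blast

text \<open>Used to bound weights: the radii \<open>1 / real (Suc n)\<close> suffice, so a metric
  space on \<open>M\<close> has a base of at most \<open>|M|\<close> times countably many
  members.\<close>

lemma is_base_mball: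
  assumes "Metric_space M d"
  shows "is_base (Metric_space.mtopology M d)
    ((\<lambda>(x, n). Metric_space.mball M d x (1 / real (Suc n))) ` (M \<times> UNIV))"
proof -
  interpret Metric_space M d by fact
  show ?thesis
    unfolding is_base_def
  proof (intro conjI allI impI ballI)
    fix U x assume "openin mtopology U \<and> x \<in> U"
    then obtain r where r: "r > 0" "mball x r \<subseteq> U" and x: "x \<in> M"
      unfolding openin_mtopology by blast
    obtain n where n: "1 / real (Suc n) < r"
      using r(1) nat_approx_posE by blast
    have "mball x (1 / real (Suc n)) \<subseteq> U"
      using n r(2) mball_subset_concentric[of "1 / real (Suc n)" r x] by fastforce
    then show "\<exists>V\<in>(\<lambda>(x, n). mball x (1 / real (Suc n))) ` (M \<times> UNIV). x \<in> V \<and> V \<subseteq> U"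
      using x by (intro bexI[of _ "mball x (1 / real (Suc n))"]) auto
  qed auto
qed

text \<open>The weight \<open>m\<close> forces at least \<open>m\<close> points, since the balls
  with reciprocal integer radii form a base. A point outside \<open>Y\<close> can then name a new
  point, because universality only admits metric spaces carried by sets of the type of
  \<open>M\<close>.\<close>

lemma urysohn_katetov_not_subset:
  assumes U: "urysohn_katetov m M d" and m: "natLeq \<le>o m" and Y: "|Y| <o m"
  shows "\<not> M \<subseteq> Y"
proof
  assume MY: "M \<subseteq> Y"
  interpret Metric_space M d using U by (simp add: urysohn_katetov_def)
  have w: "m \<le>o |\<B>|" if "is_base mtopology \<B>" for \<B>
    using that U unfolding urysohn_katetov_def has_weight_def by blast
  have M: "|M| <o m" using MY Y by (meson card_of_mono1 ordLeq_ordLess_trans)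
  show False
  proof (cases "finite M")
    \<comment> \<open>For finite \<open>M\<close> the ball base yields only a countable bound; the
      finite family of all open sets is a base that contradicts infinite weight.\<close>
    case True
    have "is_base mtopology (Collect (openin mtopology))"
      unfolding is_base_def by auto
    moreover have "finite (Collect (openin mtopology))"
      using True openin_subset[of mtopology]
      by (intro finite_subset[of "Collect (openin mtopology)" "Pow M"]) auto
    ultimately show False
      using w m natLeq_not_ordLeq_finite ordLeq_transitive by blast
  next
    case False
    have "m \<le>o |(\<lambda>(x, n). mball x (1 / real (Suc n))) ` (M \<times> UNIV)|"
      by (rule w[OF is_base_mball[OF Metric_space_axioms]])
    moreover have "|(\<lambda>(x, n). mball x (1 / real (Suc n))) ` (M \<times> UNIV)| \<le>o |M \<times> (UNIV :: nat set)|"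
      by (rule card_of_image)
    moreover have "|M \<times> (UNIV :: nat set)| =o |M|"
      using card_of_Times_infinite[of M "UNIV::nat set"] False infinite_iff_card_of_nat by blast
    ultimately have "m \<le>o |M|" using ordLeq_transitive ordLeq_ordIso_trans by blast
    then show False using M not_ordLess_ordLeq by blast
  qed
qed

text \<open>A set of cardinality below \<open>m\<close> is dense in itself, hence of density below
  \<open>m\<close>, and preservation of distances gives injectivity. Homogeneity thus reduces to a
  check of distances.\<close>

lemma urysohn_katetov_homogeneous:
  assumes U: "urysohn_katetov m M d" and A: "A \<subseteq> M" "|A| <o m"
    and f: "\<And>x. x \<in> A \<Longrightarrow> f x \<in> M"
    and dist: "\<And>x y. x \<in> A \<Longrightarrow> y \<in> A \<Longrightarrow> d (f x) (f y) = d x y"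
  obtains g where "isometry_onto M d M d g" "\<And>x. x \<in> A \<Longrightarrow> g x = f x"
proof -
  interpret Metric_space M d using U by (simp add: urysohn_katetov_def)
  have ds: "density_less (subtopology mtopology B) m" if "B \<subseteq> M" "|B| <o m" for B
  proof -
    have "topspace (subtopology mtopology B) = B"
      using that(1) by (intro topspace_subtopology_subset) simp
    then show ?thesis
      using that(2) closure_of_topspace[of "subtopology mtopology B"] unfolding density_less_def
      by (metis order_refl)
  qed
  have "inj_on f A"
  proof (rule inj_onI)
    fix x y assume xy: "x \<in> A" "y \<in> A" "f x = f y"
    then have "d x y = 0" using dist[of x y] f[of y] by simp
    then show "x = y" using xy A(1) zero[of x y] by blast
  qed
  then have "isometry_onto A d (f ` A) d f"
    using dist unfolding isometry_onto_def by (simp add: inj_on_imp_bij_betw)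
  moreover have "f ` A \<subseteq> M" using f by auto
  moreover have "|f ` A| <o m" using A(2) card_of_image ordLeq_ordLess_trans by blast
  moreover have "\<forall>A B f. A \<subseteq> M \<and> B \<subseteq> M \<and> density_less (subtopology mtopology A) m \<and>
      density_less (subtopology mtopology B) m \<and> isometry_onto A d B d f \<longrightarrow>
      (\<exists>g. isometry_onto M d M d g \<and> (\<forall>x\<in>A. g x = f x))"
    using U unfolding urysohn_katetov_def by (elim conjE)
  moreover have "density_less (subtopology mtopology A) m" using ds A by blast
  moreover have "density_less (subtopology mtopology (f ` A)) m" using ds calculation(2,3) by blast
  ultimately obtain g where "isometry_onto M d M d g \<and> (\<forall>x\<in>A. g x = f x)"
    using A(1) by (metis (no_types, lifting))
  then show thesis using that by blast
qed

text \<open>An isometric copy of \<open>Y \<union> {z}\<close> exists by universality; homogeneity moves the copy of \<open>Y\<close> back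
  to \<open>Y\<close>.\<close>

lemma katetov_extension:
  assumes U: "urysohn_katetov m M d" and m: "natLeq \<le>o m"
    and Y: "Y \<subseteq> M" "countable Y" "|Y| <o m"
    and pos: "\<And>x. x \<in> Y \<Longrightarrow> 0 < f x"
    and lip: "\<And>x y. x \<in> Y \<Longrightarrow> y \<in> Y \<Longrightarrow> f x \<le> f y + d x y"
    and tri: "\<And>x y. x \<in> Y \<Longrightarrow> y \<in> Y \<Longrightarrow> d x y \<le> f x + f y"
  obtains z where "z \<in> M" "\<And>y. y \<in> Y \<Longrightarrow> d z y = f y"
proof -
  interpret Metric_space M d using U by (simp add: urysohn_katetov_def)
  obtain p where p: "p \<in> M" "p \<notin> Y"
    using urysohn_katetov_not_subset[OF U m Y(3)] by blast
  define N where "N = insert p Y"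
  \<comment> \<open>The distances of \<open>p\<close> in \<open>M\<close> are discarded: towards
    \<open>Y\<close> they are replaced by \<open>f\<close>.\<close>
  define e where "e = (\<lambda>x y. if x \<in> Y \<and> y \<in> Y then d x y else if x \<in> Y then f x
     else if y \<in> Y then f y else 0)"
  have e: "Metric_space N e"
  proof
    show "0 \<le> e x y" for x y using pos less_imp_le unfolding e_def by auto
    show "e x y = e y x" for x y unfolding e_def by (auto simp: commute)
    show "e x y = 0 \<longleftrightarrow> x = y" if "x \<in> N" "y \<in> N" for x y
      using that p Y(1) pos[of x] pos[of y] unfolding e_def N_def by (auto simp: subset_iff)
    show "e x z \<le> e x y + e y z" if "x \<in> N" "y \<in> N" "z \<in> N" for x y z
    proof -
      have "d x z \<le> d x y + d y z" if "x \<in> Y" "y \<in> Y" "z \<in> Y" 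
        using that Y(1) triangle by blast
      \<comment> \<open>This settles the triangle inequality along the path from \<open>p\<close> to
        \<open>y\<close> and back.\<close>
      moreover have "0 \<le> f y" if "y \<in> Y" using pos[OF that] by simp
      ultimately show ?thesis
        using that p lip[of x y] lip[of z y] tri[of x z] commute[of z y] unfolding e_def N_def by auto
    qed
  qed
  have "countable ((\<lambda>(x, n). Metric_space.mball N e x (1 / real (Suc n))) ` (N \<times> UNIV))"
    using Y(2) by (simp add: N_def)
  then have "weight_le (Metric_space.mtopology N e) m"
    unfolding weight_le_def using is_base_mball[OF e] countable_card_le_natLeq m ordLeq_transitive
    by blast
  then obtain g M' where g: "M' \<subseteq> M" "isometry_onto N e M' d g"
    using U e unfolding urysohn_katetov_def by blast
  have gM: "g x \<in> M" if "x \<in> N" for x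
    using that g unfolding isometry_onto_def bij_betw_def by blast
  have dg: "d (g x) (g y) = e x y" if "x \<in> N" "y \<in> N" for x y
    using that g unfolding isometry_onto_def by blast
  have inj: "inj_on g Y"
    using g unfolding isometry_onto_def bij_betw_def N_def by (meson inj_on_subset subset_insertI)
  obtain k where k: "isometry_onto M d M d k" "\<And>x. x \<in> g ` Y \<Longrightarrow> k x = inv_into Y g x"
  proof (rule urysohn_katetov_homogeneous[OF U, of "g ` Y" "inv_into Y g"])
    show "g ` Y \<subseteq> M" using gM by (auto simp: N_def)
    show "|g ` Y| <o m" using Y(3) card_of_image ordLeq_ordLess_trans by blast
    show "inv_into Y g x \<in> M" if "x \<in> g ` Y" for x
      using that inj Y(1) by auto
    show "d (inv_into Y g x) (inv_into Y g y) = d x y" if "x \<in> g ` Y" "y \<in> g ` Y" for x y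
      using that inj dg by (auto simp: e_def N_def)
  qed blast
  show thesis
  proof
    show "k (g p) \<in> M"
      using k(1) gM unfolding isometry_onto_def bij_betw_def N_def by blast
    fix y assume y: "y \<in> Y"
    have "d (k (g p)) (k (g y)) = d (g p) (g y)"
      using k(1) gM y unfolding isometry_onto_def N_def by blast
    also have "\<dots> = f y" using dg y p by (simp add: N_def e_def)
    finally show "d (k (g p)) y = f y" using k(2) inj y by simp
  qed
qed

section \<open>From pointwise convergence to uniform convergence on bounded sets\<close>

lemma strict_mono_subsequence_pairwise:
  assumes "\<And>i. eventually (\<lambda>j. P i j) sequentially"
  obtains s :: "nat \<Rightarrow> nat" where "strict_mono s" "\<And>i j. i < j \<Longrightarrow> P (s i) (s j)"
proof -
  obtain N where N: "\<And>i j. N i \<le> j \<Longrightarrow> P i j"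
    using assms unfolding eventually_sequentially by metis
  \<comment> \<open>The sum over all \<open>i\<close> up to the current index dominates every single
    threshold \<open>N i\<close>, so the recursion need not remember which indices were chosen
    before.\<close>
  define s where "s = rec_nat 0 (\<lambda>_ k. Suc (k + (\<Sum>i\<le>k. N i)))"
  have s: "s (Suc k) = Suc (s k + (\<Sum>i\<le>s k. N i))" for k by (simp add: s_def)
  have mono: "strict_mono s" by (simp add: strict_mono_Suc_iff s)
  have "P (s i) (s j)" if ij: "i < j" for i j
  proof (rule N)
    obtain k where k: "j = Suc k" "i \<le> k" using ij by (cases j) auto
    have "s i \<le> s k" using mono k(2) by (simp add: strict_mono_less_eq)
    then have "N (s i) \<le> (\<Sum>i\<le>s k. N i)" by (intro member_le_sum) auto
    then show "N (s i) \<le> s j" by (simp add: k(1) s)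
  qed
  with mono show thesis using that by blast
qed

text \<open>If the displacement stayed above \<open>e\<close>, a subsequence would keep all \<open>y i\<close> at distance at least
  \<open>e / 4\<close> from all \<open>g j (y j)\<close>. Then the function with value \<open>C\<close> at \<open>y i\<close> and \<open>C + e / 4\<close> at
  \<open>g i (y i)\<close> is Katetov (boundedness is needed for \<open>d x y \<le> 2 * C\<close>), and a point \<open>z\<close> realising it
  is moved by at least \<open>e / 4\<close> by every \<open>g i\<close>.\<close>

lemma pointwise_imp_uniform_on_bounded:
  assumes U: "urysohn_katetov m M d" and m: "natLeq <o m"
    and g: "\<And>n::nat. isometry_onto M d M d (g n)"
    and lim: "\<And>x. x \<in> M \<Longrightarrow> (\<lambda>n. d (g n x) x) \<longlonglongrightarrow> 0"
    and y: "\<And>n. y n \<in> M" and bdd: "\<And>n. d (y n) a \<le> B" and a: "a \<in> M"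
  shows "(\<lambda>n. d (g n (y n)) (y n)) \<longlonglongrightarrow> 0"
proof (rule ccontr)
  interpret Metric_space M d using U by (simp add: urysohn_katetov_def)
  have gM: "g n x \<in> M" if "x \<in> M" for n x using isometry_ontoD(1)[OF g that] .
  have dg: "d (g n x) (g n x') = d x x'" if "x \<in> M" "x' \<in> M" for n x x'
    using isometry_ontoD(2)[OF g that] .
  assume "\<not> ?thesis"
  then obtain e where e: "e > 0" "\<not> eventually (\<lambda>n. d (g n (y n)) (y n) < e) sequentially"
    unfolding tendsto_iff by auto
  then have "infinite {n. d (g n (y n)) (y n) \<ge> e}"
    by (simp flip: cofinite_eq_sequentially add: eventually_cofinite not_less)
  then obtain r :: "nat \<Rightarrow> nat" where r: "strict_mono r" "\<And>n. d (g (r n) (y (r n))) (y (r n)) \<ge> e"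
    using infinite_enumerate[of "{n. d (g n (y n)) (y n) \<ge> e}"] by blast
  define h w where "h = g \<circ> r" and "w = y \<circ> r"
  have h: "h n x \<in> M" if "x \<in> M" for n x using that gM by (simp add: h_def)
  have dh: "d (h n x) (h n x') = d x x'" if "x \<in> M" "x' \<in> M" for n x x'
    using that dg by (simp add: h_def)
  have w: "w n \<in> M" for n using y by (simp add: w_def)
  have far: "d (h n (w n)) (w n) \<ge> e" for n using r by (simp add: h_def w_def)
  have hlim: "(\<lambda>n. d (h n x) x) \<longlonglongrightarrow> 0" if "x \<in> M" for x
    using LIMSEQ_subseq_LIMSEQ[OF lim[OF that] r(1)] by (simp add: h_def comp_def)
  have small: "eventually (\<lambda>n. d (h n x) x < c) sequentially" if "x \<in> M" "c > 0" for x c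
    using order_tendstoD(2)[OF hlim[OF that(1)] that(2)] .
  \<comment> \<open>The two distances add up to at least \<open>e\<close> and differ by less than
    \<open>e/4\<close>, because \<open>h n\<close> almost fixes \<open>x\<close>; so each exceeds
    \<open>3e/8\<close>.\<close>
  have away: "eventually (\<lambda>n. d (w n) x \<ge> e/4 \<and> d (h n (w n)) x \<ge> e/4) sequentially"
    if x: "x \<in> M" for x
  proof (rule eventually_mono)
    show "eventually (\<lambda>n. d (h n x) x < e/4) sequentially" by (intro small x) (use e(1) in simp)
    fix n assume elim: "d (h n x) x < e/4"
    have "d (h n (w n)) (w n) \<le> d (h n (w n)) x + d (w n) x"
      using triangle' h w x by blast
    moreover have "d (h n (w n)) x \<le> d (w n) x + d (h n x) x"
      using triangle[OF h[OF w] h[OF x] x, of n n n] dh[OF w x] by simp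
    moreover have "d (w n) x \<le> d (h n (w n)) x + d (h n x) x"
      using triangle'[OF h[OF w] x h[OF x], of n n n] dh[OF w x] by simp
    ultimately show "d (w n) x \<ge> e/4 \<and> d (h n (w n)) x \<ge> e/4"
      using far[of n] elim by linarith
  qed
  \<comment> \<open>\<open>away\<close> is applied to the two points of stage \<open>i\<close>. Both
    inequalities are kept so that the separation holds for either order of the indices.\<close>
  have "eventually (\<lambda>j. d (w j) (h i (w i)) \<ge> e/4 \<and> d (h j (w j)) (w i) \<ge> e/4) sequentially" for i
    using away[OF w[of i]] away[OF h[OF w[of i], of i]] by eventually_elim auto
  from strict_mono_subsequence_pairwise[where P = "\<lambda>i j. d (w j) (h i (w i)) \<ge> e/4 \<and>
      d (h j (w j)) (w i) \<ge> e/4", OF this] obtain s :: "nat \<Rightarrow> nat" where s: "strict_mono s"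
    "\<And>i j. i < j \<Longrightarrow> d (w (s j)) (h (s i) (w (s i))) \<ge> e/4 \<and> d (h (s j) (w (s j))) (w (s i)) \<ge> e/4"
    by metis
  have sep: "d (w (s i)) (h (s j) (w (s j))) \<ge> e/4" for i j
  proof (cases rule: linorder_cases[of i j])
    case equal
    then show ?thesis using far[of "s i"] e(1) commute[of "w (s i)"] by simp
  qed (use s(2)[of i j] s(2)[of j i] commute[of "w (s i)"] in auto)
  define A where "A = range (\<lambda>i. w (s i))"
  define Y where "Y = A \<union> range (\<lambda>i. h (s i) (w (s i)))"
  obtain D where D: "D > 0" "\<And>x. x \<in> Y \<Longrightarrow> d x a \<le> D"
  proof -
    \<comment> \<open>The images \<open>h n (w n)\<close> stay bounded because \<open>h n a\<close>
      converges to \<open>a\<close>, so that \<open>h n\<close> moves the centre by at most some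
      \<open>K\<close>.\<close>
    have "(\<lambda>n. d (h n a) a) \<longlonglongrightarrow> 0" using hlim a by simp
    then have "Bseq (\<lambda>n. d (h n a) a)" using convergent_imp_Bseq convergentI by blast
    then obtain K where K: "K > 0" "\<And>n. d (h n a) a \<le> K"
      unfolding Bseq_def by auto
    have B: "0 \<le> B" using bdd[of 0] nonneg order_trans by blast
    have wB: "d (w n) a \<le> B" for n using bdd by (simp add: w_def)
    have "d (h n (w n)) a \<le> B + K" for n
      using triangle[OF h[OF w] h[OF a] a, of n n n] dh[OF w a] K(2)[of n] wB[of n] by fastforce
    moreover have "d (w n) a \<le> B + K" for n using wB[of n] K(1) by simp
    ultimately show thesis using that[of "B + K"] K(1) B unfolding Y_def A_def by auto
  qed
  define f where "f = (\<lambda>x. if x \<in> A then D else D + e/4)"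
  have AM: "A \<subseteq> M" and YM: "Y \<subseteq> M" using w h unfolding A_def Y_def by auto
  have cY: "countable Y" unfolding Y_def A_def by auto
  \<comment> \<open>Ensures that \<open>f\<close> really takes the larger value at the image points,
    although it is defined by membership in \<open>A\<close>.\<close>
  have disj: "h (s i) (w (s i)) \<notin> A" for i
  proof
    assume "h (s i) (w (s i)) \<in> A"
    then obtain k where k: "h (s i) (w (s i)) = w (s k)" unfolding A_def by auto
    show False using sep[of k i] e(1) w[of "s k"] unfolding k by simp
  qed
  obtain z where z: "z \<in> M" "\<And>x. x \<in> Y \<Longrightarrow> d z x = f x"
  proof (rule katetov_extension[OF U _ YM cY])
    show "natLeq \<le>o m" using m ordLess_imp_ordLeq by blast
    show "|Y| <o m" using countable_imp_card_less[OF m cY] .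
    show "0 < f x" for x using D(1) e(1) by (simp add: f_def add_pos_pos)
    show "f x \<le> f x' + d x x'" if x: "x \<in> Y" "x' \<in> Y" for x x'
    \<comment> \<open>Only a jump upwards, from a point of \<open>A\<close> to one outside, needs
      the separation.\<close>
    proof (cases "x \<notin> A \<and> x' \<in> A")
      case True
      then obtain i where "x = h (s i) (w (s i))" using x(1) unfolding Y_def by auto
      moreover obtain j where "x' = w (s j)" using True unfolding A_def by auto
      ultimately have "e/4 \<le> d x x'" using sep[of j i] commute[of x] by simp
      then show ?thesis using True by (simp add: f_def)
    next
      case False
      then show ?thesis using e(1) nonneg[of x x'] by (auto simp: f_def)
    qed
    show "d x x' \<le> f x + f x'" if x: "x \<in> Y" "x' \<in> Y" for x x'
    proof -
      have "d x x' \<le> d x a + d x' a" using triangle' a x YM by blast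
      moreover have "D \<le> f x" "D \<le> f x'" using e(1) by (auto simp: f_def)
      ultimately show ?thesis using D(2)[OF x(1)] D(2)[OF x(2)] by linarith
    qed
  qed blast
  \<comment> \<open>The isometry \<open>h (s i)\<close> takes the pair of \<open>z\<close> and
    \<open>w (s i)\<close>, at distance \<open>D\<close>, to a pair ending in \<open>?q\<close>,
    whereas \<open>z\<close> has distance \<open>D + e/4\<close> from \<open>?q\<close>.\<close>
  have "d (h (s i) z) z \<ge> e/4" for i
  proof -
    let ?q = "h (s i) (w (s i))"
    have "d z ?q = D + e/4" using z(2)[of ?q] disj[of i] by (simp add: f_def Y_def)
    moreover have "d (h (s i) z) ?q = D"
      using dh[OF z(1) w] z(2)[of "w (s i)"] by (simp add: f_def Y_def A_def)
    moreover have "d z ?q \<le> d (h (s i) z) z + d (h (s i) z) ?q"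
      using triangle'' h z(1) w by blast
    ultimately show ?thesis by linarith
  qed
  moreover have "(\<lambda>i. d (h (s i) z) z) \<longlonglongrightarrow> 0"
    using LIMSEQ_subseq_LIMSEQ[OF hlim[OF z(1)] s(1)] by (simp add: comp_def)
  ultimately have "e/4 \<le> 0" by (intro LIMSEQ_le_const) auto
  then show False using e(1) by simp
qed

section \<open>Isometry groups\<close>

lemma carrier_iso_group:
  "g \<in> carrier (iso_group M d) \<longleftrightarrow> g \<in> extensional M \<and> isometry_onto M d M d g"
  by (auto simp: iso_group_def Bij_def isometry_onto_def)

lemma restrict_in_iso_group:
  "isometry_onto M d M d g \<Longrightarrow> restrict g M \<in> carrier (iso_group M d)"
  unfolding carrier_iso_group isometry_onto_def by (simp cong: bij_betw_cong)

lemma iso_group_mem: "g \<in> carrier (iso_group M d) \<Longrightarrow> x \<in> M \<Longrightarrow> g x \<in> M"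
  and iso_group_dist:
    "g \<in> carrier (iso_group M d) \<Longrightarrow> x \<in> M \<Longrightarrow> y \<in> M \<Longrightarrow> d (g x) (g y) = d x y"
  using isometry_ontoD unfolding carrier_iso_group by metis+

lemma one_iso_group: "x \<in> M \<Longrightarrow> \<one>\<^bsub>iso_group M d\<^esub> x = x"
  by (simp add: iso_group_def BijGroup_def)

lemma mult_iso_group:
  assumes "g \<in> carrier (iso_group M d)" "h \<in> carrier (iso_group M d)"
  shows "g \<otimes>\<^bsub>iso_group M d\<^esub> h = compose M g h"
  using assms by (simp add: iso_group_def BijGroup_def)

text \<open>\<open>iso_group\<close> differs from \<open>BijGroup\<close> only in its carrier, so
  closure properties suffice for the group axioms.\<close>

lemma subgroup_iso_group: "subgroup (carrier (iso_group M d)) (BijGroup M)"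
proof (rule group.subgroupI[OF group_BijGroup])
  let ?C = "carrier (iso_group M d)"
  have C: "?C \<subseteq> Bij M" by (auto simp: iso_group_def)
  then show "?C \<subseteq> carrier (BijGroup M)" by (simp add: BijGroup_def)
  show "?C \<noteq> {}"
    using restrict_in_iso_group[of M d id] unfolding isometry_onto_def by auto
  show "inv\<^bsub>BijGroup M\<^esub> g \<in> ?C" if g: "g \<in> ?C" for g
  proof -
    have "g \<in> Bij M" using C g by auto
    moreover have bij: "bij_betw g M M" using g by (simp add: carrier_iso_group isometry_onto_def)
    have "isometry_onto M d M d (inv_into M g)"
      unfolding isometry_onto_def
    proof (intro conjI ballI bij_betw_inv_into[OF bij])
      fix x y assume xy: "x \<in> M" "y \<in> M"
      then have *: "inv_into M g x \<in> M" "inv_into M g y \<in> M"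
        using bij by (auto simp: bij_betw_def inv_into_into)
      have "g (inv_into M g x) = x" "g (inv_into M g y) = y"
        using bij xy by (auto simp: bij_betw_inv_into_right)
      then show "d (inv_into M g x) (inv_into M g y) = d x y"
        using iso_group_dist[OF g *] by simp
    qed
    ultimately show ?thesis by (simp add: inv_BijGroup restrict_in_iso_group)
  qed
  show "g \<otimes>\<^bsub>BijGroup M\<^esub> h \<in> ?C" if g: "g \<in> ?C" and h: "h \<in> ?C" for g h
  proof -
    have "isometry_onto M d M d (g \<circ> h)"
      using g h iso_group_mem[OF h] unfolding carrier_iso_group isometry_onto_def
      by (auto intro: bij_betw_trans)
    then have "compose M g h \<in> ?C"
      using restrict_in_iso_group by (fastforce simp: compose_def comp_def)
    then show ?thesis using g h C by (auto simp: BijGroup_def)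
  qed
qed

lemma group_iso_group: "group (iso_group M d)"
  using subgroup.subgroup_is_group[OF subgroup_iso_group group_BijGroup, of M d]
  by (simp add: iso_group_def)

lemma topspace_iso_topology:
  assumes "Metric_space M d"
  shows "topspace (iso_topology M d) = carrier (iso_group M d)"
proof -
  interpret Metric_space M d by fact
  show ?thesis
    unfolding iso_topology_def
    by (auto simp: topspace_product_topology_alt carrier_iso_group extensional_def
        dest: isometry_ontoD)
qed

lemma continuous_map_evaluation:
  assumes "x \<in> M"
  shows "continuous_map (iso_topology M d) (Metric_space.mtopology M d) (\<lambda>g. g x)"
  unfolding iso_topology_def
  by (rule continuous_map_from_subtopology[OF continuous_map_product_projection[OF assms]])

lemma openin_iso_topology_ball:
  assumes "Metric_space M d" "a \<in> M" "x \<in> M"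
  shows "openin (iso_topology M d) {g \<in> carrier (iso_group M d). d a (g x) < e}"
proof -
  interpret Metric_space M d by fact
  have "openin (iso_topology M d) {g \<in> topspace (iso_topology M d). g x \<in> mball a e}"
    using continuous_map_evaluation[OF assms(3)] openin_mball
    by (rule openin_continuous_map_preimage)
  moreover have "{g \<in> topspace (iso_topology M d). g x \<in> mball a e}
      = {g \<in> carrier (iso_group M d). d a (g x) < e}"
    using assms iso_group_mem by (auto simp: topspace_iso_topology)
  ultimately show ?thesis by simp
qed

text \<open>A basic open set of the product restricts only finitely many coordinates; these form
  \<open>X\<close>, and \<open>e\<close> is the least of the radii found there.\<close>

lemma iso_topology_neighbourhood:
  assumes "Metric_space M d" and W: "openin (iso_topology M d) W" "g \<in> W"
  obtains X e where "finite X" "X \<subseteq> M" "e > 0"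
    "\<And>k. k \<in> carrier (iso_group M d) \<Longrightarrow> (\<And>x. x \<in> X \<Longrightarrow> d (g x) (k x) < e) \<Longrightarrow> k \<in> W"
proof -
  interpret Metric_space M d by fact
  obtain T where T: "openin (product_topology (\<lambda>_. mtopology) M) T"
    "W = T \<inter> carrier (iso_group M d)"
    using W(1) unfolding iso_topology_def openin_subtopology by blast
  have "g \<in> T" using W(2) T(2) by simp
  with T(1) have "\<exists>B. finite {i \<in> M. B i \<noteq> M} \<and> (\<forall>i\<in>M. openin mtopology (B i)) \<and>
      g \<in> Pi\<^sub>E M B \<and> Pi\<^sub>E M B \<subseteq> T"
    unfolding openin_product_topology_alt topspace_mtopology by (rule bspec)
  then obtain B where B: "finite {i \<in> M. B i \<noteq> M}" "\<And>i. i \<in> M \<Longrightarrow> openin mtopology (B i)"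
    "g \<in> Pi\<^sub>E M B" "Pi\<^sub>E M B \<subseteq> T"
    by blast
  define X where "X = {i \<in> M. B i \<noteq> M}"
  have "\<exists>r>0. mball (g i) r \<subseteq> B i" if "i \<in> M" for i
    using B(2)[OF that] PiE_mem[OF B(3) that] unfolding openin_mtopology by blast
  then obtain r where r: "\<And>i. i \<in> M \<Longrightarrow> r i > 0 \<and> mball (g i) (r i) \<subseteq> B i" by metis
  \<comment> \<open>The inserted 1 keeps the minimum defined when no coordinate is
    restricted.\<close>
  define e where "e = Min (insert 1 (r ` X))"
  have fin: "finite X" using B(1) by (simp add: X_def)
  have g: "g \<in> carrier (iso_group M d)" using W(2) T(2) by blast
  show thesis
  proof
    show "finite X" "X \<subseteq> M" using fin by (auto simp: X_def)
    show "e > 0" unfolding e_def using fin r by (subst Min_gr_iff) (auto simp: X_def)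
    fix k assume k: "k \<in> carrier (iso_group M d)" and close: "\<And>x. x \<in> X \<Longrightarrow> d (g x) (k x) < e"
    have "k i \<in> B i" if i: "i \<in> M" for i
    proof (cases "i \<in> X")
      case True
      have "e \<le> r i" unfolding e_def using fin True by simp
      then have "k i \<in> mball (g i) (r i)"
        using close[OF True] iso_group_mem[OF k i] iso_group_mem[OF g i] by simp
      then show ?thesis using r[OF i] by blast
    next
      case False
      then show ?thesis using iso_group_mem[OF k i] i by (simp add: X_def)
    qed
    then have "k \<in> Pi\<^sub>E M B" using k by (auto simp: carrier_iso_group PiE_iff)
    then show "k \<in> W" using T(2) k B(4) by blast
  qed
qed

section \<open>Isometry groups as Hausdorff topological groups, and transport of structure\<close>

lemma continuous_map_into_iso_topology:
  assumes "Metric_space M d"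
    and "\<And>z. z \<in> topspace Z \<Longrightarrow> F z \<in> carrier (iso_group M d)"
    and "\<And>x. x \<in> M \<Longrightarrow> continuous_map Z (Metric_space.mtopology M d) (\<lambda>z. F z x)"
  shows "continuous_map Z (iso_topology M d) F"
  unfolding iso_topology_def continuous_map_in_subtopology continuous_map_componentwise
  using assms by (auto simp: carrier_iso_group)

lemma topological_group_iso_group:
  assumes "Metric_space M d"
  shows "topological_group (iso_group M d) (iso_topology M d)"
proof -
  interpret Metric_space M d by fact
  let ?G = "iso_group M d" and ?T = "iso_topology M d"
  interpret G: group ?G by (rule group_iso_group)
  note top = topspace_iso_topology[OF assms] and ball = openin_iso_topology_ball[OF assms]
  have "continuous_map (prod_topology ?T ?T) ?T (\<lambda>(g, h). g \<otimes>\<^bsub>?G\<^esub> h)"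
  proof (rule continuous_map_into_iso_topology[OF assms])
    fix x assume x: "x \<in> M"
    show "continuous_map (prod_topology ?T ?T) mtopology (\<lambda>z. (case z of (g, h) \<Rightarrow> g \<otimes>\<^bsub>?G\<^esub> h) x)"
      unfolding continuous_map_to_metric
    proof (intro ballI allI impI)
      fix z and e :: real assume z: "z \<in> topspace (prod_topology ?T ?T)" and e: "e > 0"
      obtain g h where gh: "z = (g, h)" "g \<in> carrier ?G" "h \<in> carrier ?G"
        using z by (auto simp: top)
      note hx = iso_group_mem[OF gh(3) x]
      note ghx = iso_group_mem[OF gh(2) hx]
      let ?A = "{g' \<in> carrier ?G. d (g (h x)) (g' (h x)) < e/2}"
      let ?B = "{h' \<in> carrier ?G. d (h x) (h' x) < e/2}"
      have "openin (prod_topology ?T ?T) (?A \<times> ?B)"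
        unfolding openin_prod_Times_iff using ball[OF ghx hx] ball[OF hx x] by blast
      moreover have "z \<in> ?A \<times> ?B" using gh e hx ghx by simp
      moreover have "(case z' of (g, h) \<Rightarrow> g \<otimes>\<^bsub>?G\<^esub> h) x \<in> mball ((case z of (g, h) \<Rightarrow> g \<otimes>\<^bsub>?G\<^esub> h) x) e"
        if z': "z' \<in> ?A \<times> ?B" for z'
      proof -
        obtain g' h' where gh': "z' = (g', h')" "g' \<in> ?A" "h' \<in> ?B" using z' by auto
        then have c: "g' \<in> carrier ?G" "h' \<in> carrier ?G" by auto
        note h'x = iso_group_mem[OF c(2) x]
        \<comment> \<open>The first summand is controlled by \<open>g'\<close> at the point
          \<open>h x\<close>, the second, once \<open>g'\<close> is cancelled, by \<open>h'\<close>
          at \<open>x\<close>.\<close>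
        have "d (g (h x)) (g' (h' x)) \<le> d (g (h x)) (g' (h x)) + d (g' (h x)) (g' (h' x))"
          by (intro triangle ghx iso_group_mem[OF c(1)] hx h'x)
        also have "d (g' (h x)) (g' (h' x)) = d (h x) (h' x)"
          by (rule iso_group_dist[OF c(1) hx h'x])
        finally have "d (g (h x)) (g' (h' x)) < e" using gh' by simp
        then show ?thesis
          using gh c gh'(1) ghx h'x x iso_group_mem[OF c(1) h'x]
          by (simp add: mult_iso_group compose_eq)
      qed
      ultimately show "\<exists>U. openin (prod_topology ?T ?T) U \<and> z \<in> U \<and>
          (\<forall>y\<in>U. (case y of (g, h) \<Rightarrow> g \<otimes>\<^bsub>?G\<^esub> h) x \<in> mball ((case z of (g, h) \<Rightarrow> g \<otimes>\<^bsub>?G\<^esub> h) x) e)"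
        by blast
    qed
  qed (auto simp: top)
  moreover have "continuous_map ?T ?T (\<lambda>g. inv\<^bsub>?G\<^esub> g)"
  proof (rule continuous_map_into_iso_topology[OF assms])
    fix x assume x: "x \<in> M"
    have cancel: "g ((inv\<^bsub>?G\<^esub> g) x) = x" "(inv\<^bsub>?G\<^esub> g) x \<in> M" if g: "g \<in> carrier ?G" for g
    proof -
      have "g ((inv\<^bsub>?G\<^esub> g) x) = (g \<otimes>\<^bsub>?G\<^esub> inv\<^bsub>?G\<^esub> g) x"
        using g x by (simp add: mult_iso_group compose_eq)
      then show "g ((inv\<^bsub>?G\<^esub> g) x) = x" using g x by (simp add: one_iso_group)
      show "(inv\<^bsub>?G\<^esub> g) x \<in> M" by (rule iso_group_mem[OF G.inv_closed[OF g] x])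
    qed
    show "continuous_map ?T mtopology (\<lambda>g. (inv\<^bsub>?G\<^esub> g) x)"
      unfolding continuous_map_to_metric
    proof (intro ballI allI impI)
      fix g and e :: real assume "g \<in> topspace ?T" and e: "e > 0"
      then have g: "g \<in> carrier ?G" by (simp add: top)
      \<comment> \<open>Inversion is tested at the preimage of \<open>x\<close>: applying
        \<open>k\<close> turns the distance between the two preimages into the distance from
        \<open>k ?y\<close> to \<open>x\<close>, which is \<open>g ?y\<close>.\<close>
      let ?y = "(inv\<^bsub>?G\<^esub> g) x"
      let ?A = "{k \<in> carrier ?G. d (g ?y) (k ?y) < e}"
      have "openin ?T ?A" by (rule ball) (simp_all add: cancel[OF g] x)
      moreover have "g \<in> ?A" using g e cancel[OF g] x by simp
      moreover have "(inv\<^bsub>?G\<^esub> k) x \<in> mball ?y e" if k: "k \<in> ?A" for k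
      proof -
        have kc: "k \<in> carrier ?G" using k by simp
        have "d (k ?y) (k ((inv\<^bsub>?G\<^esub> k) x)) = d ?y ((inv\<^bsub>?G\<^esub> k) x)"
          by (intro iso_group_dist[OF kc] cancel(2) g kc)
        then show ?thesis using k cancel[OF g] cancel[OF kc] by (simp add: commute[of x "k ?y"])
      qed
      ultimately show "\<exists>U. openin ?T U \<and> g \<in> U \<and> (\<forall>k\<in>U. (inv\<^bsub>?G\<^esub> k) x \<in> mball ?y e)"
        by blast
    qed
  qed (simp add: top)
  ultimately show ?thesis
    unfolding topological_group_def by (simp add: top)
qed

lemma Hausdorff_space_iso_topology:
  assumes "Metric_space M d"
  shows "Hausdorff_space (iso_topology M d)"
  unfolding iso_topology_def
  by (intro Hausdorff_space_subtopology)
    (simp add: Hausdorff_space_product_topology Metric_space.Hausdorff_space_mtopology[OF assms])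

text \<open>Universality is formulated for groups on a fixed type, so a counterexample living on
  another type has to be copied there along an injection.\<close>

lemma topological_group_transport:
  assumes G: "topological_group G S" and inj: "inj_on \<phi> (carrier G)"
  obtains G' S' where "topological_group G' S'" "\<phi> \<in> iso G G'" "homeomorphic_map S S' \<phi>"
proof -
  define \<psi> where "\<psi> = inv_into (carrier G) \<phi>"
  define G' where "G' = \<lparr>carrier = \<phi> ` carrier G, mult = (\<lambda>a b. \<phi> (\<psi> a \<otimes>\<^bsub>G\<^esub> \<psi> b)), one = \<phi> \<one>\<^bsub>G\<^esub>\<rparr>"
  \<comment> \<open>Pulling back along the inverse \<open>\<psi>\<close> makes \<open>\<phi>\<close>
    a homeomorphism, and the operations of \<open>G'\<close> become composites of continuous
    maps.\<close>
  define S' where "S' = pullback_topology (\<phi> ` carrier G) \<psi> S"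
  interpret G: group G using G by (simp add: topological_group_def)
  have top: "topspace S = carrier G" using G by (simp add: topological_group_def)
  have \<psi>\<phi>: "\<psi> (\<phi> x) = x" if "x \<in> carrier G" for x using inj that by (simp add: \<psi>_def)
  have top': "topspace S' = \<phi> ` carrier G"
    using \<psi>\<phi> by (auto simp: S'_def topspace_pullback_topology top)
  have carG': "carrier G' = topspace S'" by (simp add: G'_def top')
  have c\<psi>: "continuous_map S' S \<psi>"
    using continuous_map_pullback[of S S id "\<phi> ` carrier G" \<psi>] by (simp add: S'_def)
  have c\<phi>: "continuous_map S S' \<phi>"
    unfolding S'_def
  proof (rule continuous_map_pullback')
    show "continuous_map S S (\<psi> \<circ> \<phi>)"
      by (rule continuous_map_eq[where f = id]) (simp_all add: top \<psi>\<phi>)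
    show "topspace S \<subseteq> \<phi> -` (\<phi> ` carrier G)" by (auto simp: top)
  qed
  have "homeomorphic_maps S S' \<phi> \<psi>"
    unfolding homeomorphic_maps_def using c\<psi> c\<phi> by (auto simp: top top' \<psi>\<phi>)
  then have hm: "homeomorphic_map S S' \<phi>" unfolding homeomorphic_map_maps by blast
  have iso: "\<phi> \<in> iso G G'"
    unfolding iso_iff hom_def using inj by (auto simp: G'_def \<psi>\<phi>)
  have grp: "group G'"
  proof (rule groupI)
    show "\<exists>y\<in>carrier G'. y \<otimes>\<^bsub>G'\<^esub> x = \<one>\<^bsub>G'\<^esub>" if x: "x \<in> carrier G'" for x
    proof -
      obtain u where "u \<in> carrier G" "x = \<phi> u" using x by (auto simp: G'_def)
      then show ?thesis by (intro bexI[of _ "\<phi> (inv\<^bsub>G\<^esub> u)"]) (auto simp: G'_def \<psi>\<phi>)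
    qed
  qed (auto simp: G'_def \<psi>\<phi> G.m_assoc)
  have hom: "group_hom G G' \<phi>"
    using iso grp by (simp add: group_hom_def group_hom_axioms_def iso_iff)
  have inv': "inv\<^bsub>G'\<^esub> a = \<phi> (inv\<^bsub>G\<^esub> (\<psi> a))" if a: "a \<in> carrier G'" for a
  proof -
    obtain u where u: "u \<in> carrier G" "a = \<phi> u" using a by (auto simp: G'_def)
    then show ?thesis using group_hom.hom_inv[OF hom u(1)] by (simp add: \<psi>\<phi>)
  qed
  have fst': "continuous_map (prod_topology S' S') S (\<psi> \<circ> fst)"
    and snd': "continuous_map (prod_topology S' S') S (\<psi> \<circ> snd)"
    using continuous_map_compose[OF continuous_map_fst c\<psi>] continuous_map_compose[OF continuous_map_snd c\<psi>]
    by auto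
  have pair: "continuous_map (prod_topology S' S') (prod_topology S S) (\<lambda>z. (\<psi> (fst z), \<psi> (snd z)))"
    using fst' snd' by (simp add: continuous_map_pairwise comp_def)
  have cmult: "continuous_map (prod_topology S S) S (\<lambda>(x, y). x \<otimes>\<^bsub>G\<^esub> y)"
    and cinv: "continuous_map S S (\<lambda>x. inv\<^bsub>G\<^esub> x)"
    using G by (simp_all add: topological_group_def)
  have "continuous_map (prod_topology S' S') S'
      (\<phi> \<circ> ((\<lambda>(x, y). x \<otimes>\<^bsub>G\<^esub> y) \<circ> (\<lambda>z. (\<psi> (fst z), \<psi> (snd z)))))"
    by (rule continuous_map_compose[OF continuous_map_compose[OF pair cmult] c\<phi>])
  moreover have "\<phi> \<circ> ((\<lambda>(x, y). x \<otimes>\<^bsub>G\<^esub> y) \<circ> (\<lambda>z. (\<psi> (fst z), \<psi> (snd z)))) = (\<lambda>(x, y). x \<otimes>\<^bsub>G'\<^esub> y)"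
    by (auto simp: G'_def)
  moreover have "continuous_map S' S' (\<lambda>x. inv\<^bsub>G'\<^esub> x)"
    using continuous_map_compose[OF continuous_map_compose[OF c\<psi> cinv] c\<phi>]
    by (rule continuous_map_eq) (simp add: inv' carG')
  ultimately have "topological_group G' S'"
    using grp carG' unfolding topological_group_def by simp
  then show thesis using that iso hm by blast
qed

section \<open>The obstruction to embedding\<close>

text \<open>Coarse boundedness: if \<open>h\<close> embeds the group and \<open>x\<close> is a point, the criterion may be applied to a
  finite set \<open>A\<close> whose pointwise stabiliser moves \<open>x\<close> by less than 1. The orbit points
  \<open>h (v n) (h f x)\<close> are then bounded, so \<open>h (g n)\<close> moves them by distances tending to 0, while the
  conjugates of \<open>g n\<close> by \<open>v n f\<close> move \<open>p\<close> by at least \<open>r\<close>.\<close>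

lemma not_embeds_iso_group:
  assumes U: "Metric_space U d" and Um: "urysohn_katetov m Um dm" and m: "natLeq <o m"
    and p: "p \<in> U" and r: "r > 0"
    and crit: "\<And>A. finite A \<Longrightarrow> A \<subseteq> U \<Longrightarrow> \<exists>f\<in>carrier (iso_group U d). \<exists>v g :: nat \<Rightarrow> _.
      (\<forall>n. v n \<in> carrier (iso_group U d) \<and> g n \<in> carrier (iso_group U d) \<and>
        (\<forall>a\<in>A. v n a = a) \<and> r \<le> d (g n (v n (f p))) (v n (f p))) \<and>
      (\<forall>x\<in>U. (\<lambda>n. d (g n x) x) \<longlonglongrightarrow> 0)"
  shows "\<not> embeds_as_topological_subgroup (iso_group U d) (iso_topology U d)
    (iso_group Um dm) (iso_topology Um dm)"
proof
  let ?G = "iso_group U d" and ?S = "iso_topology U d"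
  let ?H = "iso_group Um dm" and ?T = "iso_topology Um dm"
  interpret U: Metric_space U d by fact
  interpret Um: Metric_space Um dm using Um by (simp add: urysohn_katetov_def)
  interpret G: group ?G by (rule group_iso_group)
  interpret H: group ?H by (rule group_iso_group)
  note topG = topspace_iso_topology[OF U]
  note topH = topspace_iso_topology[OF Um.Metric_space_axioms]
  assume "embeds_as_topological_subgroup ?G ?S ?H ?T"
  then obtain K h where K: "subgroup K ?H" and h: "h \<in> iso ?G (?H\<lparr>carrier := K\<rparr>)"
    and hom: "homeomorphic_map ?S (subtopology ?T K) h"
    unfolding embeds_as_topological_subgroup_def by blast
  have KH: "K \<subseteq> carrier ?H" using K by (rule subgroup.subset)
  have hK: "h u \<in> K" and hc: "h u \<in> carrier ?H" if "u \<in> carrier ?G" for u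
    using that h KH unfolding iso_iff by auto
  have hmult: "h (u \<otimes>\<^bsub>?G\<^esub> w) = h u \<otimes>\<^bsub>?H\<^esub> h w" if "u \<in> carrier ?G" "w \<in> carrier ?G" for u w
    using that h unfolding iso_iff hom_def by simp
  have "h \<in> hom ?G ?H" unfolding hom_def using hc hmult by simp
  then interpret h: group_hom ?G ?H h
    by (simp add: group_hom_def group_hom_axioms_def G.group_axioms H.group_axioms)
  have inj: "inj_on h (carrier ?G)" using h by (simp add: iso_iff)
  have ch: "continuous_map ?S ?T h"
    using homeomorphic_imp_continuous_map[OF hom] continuous_map_in_subtopology by blast
  \<comment> \<open>Continuity of \<open>h\<close> at the identity, read off at one point
    \<open>x\<close>: control of \<open>u\<close> on a finite subset of \<open>U\<close> controls
    the displacement of \<open>x\<close> under \<open>h u\<close>.\<close>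
  have stab: "\<exists>A e. finite A \<and> A \<subseteq> U \<and> e > 0 \<and>
      (\<forall>u\<in>carrier ?G. (\<forall>a\<in>A. d a (u a) < e) \<longrightarrow> dm x (h u x) < c)"
    if x: "x \<in> Um" and c: "c > 0" for x c
  proof -
    let ?V = "{u \<in> topspace ?S. h u \<in> {k \<in> carrier ?H. dm x (k x) < c}}"
    have "openin ?S ?V"
      using ch openin_iso_topology_ball[OF Um.Metric_space_axioms x x]
      by (rule openin_continuous_map_preimage)
    moreover have "\<one>\<^bsub>?G\<^esub> \<in> ?V" using x c by (simp add: topG one_iso_group)
    ultimately show ?thesis
    proof (rule iso_topology_neighbourhood[OF U])
      fix X e assume "finite X" "X \<subseteq> U" "0 < e"
        and X: "\<And>k. k \<in> carrier ?G \<Longrightarrow> (\<And>x. x \<in> X \<Longrightarrow> d (\<one>\<^bsub>?G\<^esub> x) (k x) < e) \<Longrightarrow> k \<in> ?V"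
      have "dm x (h u x) < c" if "u \<in> carrier ?G" "\<forall>a\<in>X. d a (u a) < e" for u
      proof -
        have "u \<in> ?V" using X[OF that(1)] that(2) \<open>X \<subseteq> U\<close> by (auto simp: one_iso_group subset_iff)
        then show ?thesis by simp
      qed
      then show ?thesis using \<open>finite X\<close> \<open>X \<subseteq> U\<close> \<open>0 < e\<close> by blast
    qed
  qed
  \<comment> \<open>Since \<open>h\<close> is open onto \<open>K\<close>, small displacement of
    \<open>p\<close> can be detected in the target: it follows from displacements below
    \<open>e\<close> on a finite set \<open>X\<close>.\<close>
  define W where "W = {u \<in> carrier ?G. d p (u p) < r}"
  have "openin ?S W" unfolding W_def by (rule openin_iso_topology_ball[OF U p p])
  then have "openin (subtopology ?T K) (h ` W)"
    using homeomorphic_imp_open_map[OF hom] by (simp add: open_map_def)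
  then obtain T where T: "openin ?T T" "h ` W = T \<inter> K" unfolding openin_subtopology by blast
  have "\<one>\<^bsub>?G\<^esub> \<in> W" using p r by (simp add: W_def one_iso_group)
  then have "\<one>\<^bsub>?H\<^esub> \<in> T" using T(2) h.hom_one by (metis IntD1 imageI)
  obtain X e where X: "finite X" "X \<subseteq> Um" "e > 0"
    and XT: "\<And>k. k \<in> carrier ?H \<Longrightarrow> (\<And>x. x \<in> X \<Longrightarrow> dm (\<one>\<^bsub>?H\<^esub> x) (k x) < e) \<Longrightarrow> k \<in> T"
    by (rule iso_topology_neighbourhood[OF Um.Metric_space_axioms T(1) \<open>\<one>\<^bsub>?H\<^esub> \<in> T\<close>]) blast
  \<comment> \<open>Elements fixing \<open>A\<close> pointwise meet every tolerance
    \<open>e'\<close>, so the tolerances disappear and the finite sets can be united over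
    \<open>X\<close>. Any positive bound would do in place of 1, as it only has to keep orbits
    bounded.\<close>
  have "\<exists>A. finite A \<and> A \<subseteq> U \<and> (\<forall>u\<in>carrier ?G. (\<forall>a\<in>A. u a = a) \<longrightarrow> dm x (h u x) < 1)"
    if "x \<in> X" for x
  proof -
    have x: "x \<in> Um" using that X(2) by blast
    obtain A e' where A: "finite A" "A \<subseteq> U" "e' > 0"
      "\<forall>u\<in>carrier ?G. (\<forall>a\<in>A. d a (u a) < e') \<longrightarrow> dm x (h u x) < 1"
      using stab[OF x zero_less_one] by blast
    have "dm x (h u x) < 1" if u: "u \<in> carrier ?G" "\<forall>a\<in>A. u a = a" for u
    proof -
      have "\<forall>a\<in>A. d a (u a) < e'" using u(2) A(2,3) by (simp add: subset_iff)
      with A(4) u(1) show ?thesis by simp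
    qed
    with A(1,2) show ?thesis by (intro exI[of _ A]) simp
  qed
  then obtain A where A: "\<And>x. x \<in> X \<Longrightarrow> finite (A x) \<and> A x \<subseteq> U \<and>
      (\<forall>u\<in>carrier ?G. (\<forall>a\<in>A x. u a = a) \<longrightarrow> dm x (h u x) < 1)" by metis
  have "finite (\<Union>x\<in>X. A x)" "(\<Union>x\<in>X. A x) \<subseteq> U" using A X(1) by auto
  from crit[OF this] obtain f where f: "f \<in> carrier ?G" and "\<exists>v g :: nat \<Rightarrow> _.
      (\<forall>n. v n \<in> carrier ?G \<and> g n \<in> carrier ?G \<and> (\<forall>a\<in>\<Union>x\<in>X. A x. v n a = a) \<and>
        r \<le> d (g n (v n (f p))) (v n (f p))) \<and>
      (\<forall>x\<in>U. (\<lambda>n. d (g n x) x) \<longlonglongrightarrow> 0)"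
    by (elim bexE)
  then obtain v g :: "nat \<Rightarrow> _" where
    vg: "\<forall>n. v n \<in> carrier ?G \<and> g n \<in> carrier ?G \<and> (\<forall>a\<in>\<Union>x\<in>X. A x. v n a = a) \<and>
        r \<le> d (g n (v n (f p))) (v n (f p))"
      "\<forall>x\<in>U. (\<lambda>n. d (g n x) x) \<longlonglongrightarrow> 0"
    by (elim exE conjE)
  have v: "v n \<in> carrier ?G" and g: "g n \<in> carrier ?G"
    and fixed: "\<forall>a\<in>\<Union>x\<in>X. A x. v n a = a"
    and far: "r \<le> d (g n (v n (f p))) (v n (f p))" for n
    using vg(1) by simp_all
  have lim: "(\<lambda>n. d (g n x) x) \<longlonglongrightarrow> 0" if "x \<in> U" for x
    using vg(2) that by simp
  have hlim: "(\<lambda>n. dm (h (g n) x) x) \<longlonglongrightarrow> 0" if x: "x \<in> Um" for x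
  proof (rule tendstoI)
    fix c :: real assume "c > 0"
    from stab[OF x this] obtain B e' where B: "finite B" "B \<subseteq> U" "e' > 0"
      "\<forall>u\<in>carrier ?G. (\<forall>a\<in>B. d a (u a) < e') \<longrightarrow> dm x (h u x) < c" by blast
    have "\<forall>a\<in>B. \<forall>\<^sub>F n in sequentially. d (g n a) a < e'"
      using order_tendstoD(2)[OF lim B(3)] B(2) by blast
    then have "\<forall>\<^sub>F n in sequentially. \<forall>a\<in>B. d (g n a) a < e'"
      using B(1) by (simp add: eventually_ball_finite)
    then show "\<forall>\<^sub>F n in sequentially. dist (dm (h (g n) x) x) 0 < c"
    proof (rule eventually_mono)
      fix n assume "\<forall>a\<in>B. d (g n a) a < e'"
      then have "dm x (h (g n) x) < c" using B(4) g U.commute by metis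
      then show "dist (dm (h (g n) x) x) 0 < c" using Um.commute by (simp add: dist_real_def)
    qed
  qed
  define w where "w n = v n \<otimes>\<^bsub>?G\<^esub> f" for n
  have w: "w n \<in> carrier ?G" for n using v f by (simp add: w_def)
  have "(\<lambda>n. dm (h (g n) (h (w n) x)) (h (w n) x)) \<longlonglongrightarrow> 0" if xX: "x \<in> X" for x
  proof (rule pointwise_imp_uniform_on_bounded[OF Um m _ hlim])
    have x: "x \<in> Um" using xX X(2) by blast
    show "isometry_onto Um dm Um dm (h (g n))" for n
      using hc[OF g] by (simp add: carrier_iso_group)
    show "h (w n) x \<in> Um" for n using hc[OF w] x by (rule iso_group_mem)
    show "x \<in> Um" by fact
    show "dm (h (w n) x) x \<le> dm (h f x) x + 1" for n
    proof -
      note fx = iso_group_mem[OF hc[OF f] x]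
      have "h (w n) x = h (v n) (h f x)"
        unfolding w_def using hmult v f hc x by (simp add: mult_iso_group compose_eq)
      moreover have "dm (h (v n) (h f x)) x \<le> dm (h (v n) (h f x)) (h (v n) x) + dm (h (v n) x) x"
        using Um.triangle iso_group_mem[OF hc[OF v]] fx x by blast
      moreover have "dm (h (v n) (h f x)) (h (v n) x) = dm (h f x) x"
        using iso_group_dist[OF hc[OF v]] fx x by blast
      moreover have "dm x (h (v n) x) < 1" using A[OF xX] v[of n] fixed[of n] xX by blast
      ultimately show ?thesis using Um.commute[of x "h (v n) x"] by simp
    qed
  qed
  then have "\<forall>x\<in>X. \<forall>\<^sub>F n in sequentially. dm (h (g n) (h (w n) x)) (h (w n) x) < e"
    using order_tendstoD(2) X(3) by blast
  then have ev: "\<forall>\<^sub>F n in sequentially. \<forall>x\<in>X. dm (h (g n) (h (w n) x)) (h (w n) x) < e"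
    using X(1) by (simp add: eventually_ball_finite)
  obtain n where n: "\<forall>x\<in>X. dm (h (g n) (h (w n) x)) (h (w n) x) < e"
    using eventually_happens'[OF sequentially_bot ev] ..
  \<comment> \<open>The conjugate of \<open>g n\<close> by \<open>w n\<close>. Rewritten as
    \<open>wu\<close>, it allows displacements to be compared without evaluating the inverse at
    points.\<close>
  define u where "u = inv\<^bsub>?G\<^esub> (w n) \<otimes>\<^bsub>?G\<^esub> (g n \<otimes>\<^bsub>?G\<^esub> w n)"
  have u: "u \<in> carrier ?G" using w g by (simp add: u_def)
  have wu: "w n \<otimes>\<^bsub>?G\<^esub> u = g n \<otimes>\<^bsub>?G\<^esub> w n"
    unfolding u_def using w g by (simp add: G.m_assoc[symmetric])
  have "h u \<in> T"
  proof (rule XT[OF hc[OF u]])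
    fix x assume xX: "x \<in> X"
    then have x: "x \<in> Um" using X(2) by blast
    have "h (w n) \<otimes>\<^bsub>?H\<^esub> h u = h (g n) \<otimes>\<^bsub>?H\<^esub> h (w n)"
      using hmult[OF w u, of n] hmult[OF g w, of n n] wu by simp
    then have "compose Um (h (w n)) (h u) x = compose Um (h (g n)) (h (w n)) x"
      by (simp only: mult_iso_group[OF hc[OF w] hc[OF u]] mult_iso_group[OF hc[OF g] hc[OF w]])
    then have "h (w n) (h u x) = h (g n) (h (w n) x)" using x by (simp add: compose_eq)
    moreover have "dm (h (w n) (h u x)) (h (w n) x) = dm (h u x) x"
      using iso_group_dist[OF hc[OF w]] iso_group_mem[OF hc[OF u] x] x by blast
    ultimately have "dm (h u x) x < e" using bspec[OF n xX] by simp
    then show "dm (\<one>\<^bsub>?H\<^esub> x) (h u x) < e" using x Um.commute by (simp add: one_iso_group)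
  qed
  \<comment> \<open>By injectivity \<open>u\<close> itself moves \<open>p\<close> by less than
    \<open>r\<close>; but \<open>w n\<close> turns this displacement into that of
    \<open>v n (f p)\<close> under \<open>g n\<close>, which is at least \<open>r\<close>.\<close>
  then have "h u \<in> h ` W" using T(2) hK[OF u] by blast
  then have "u \<in> W" using inj u by (auto simp: W_def inj_on_def)
  then have "d (u p) p < r" using U.commute by (simp add: W_def)
  moreover have "d (w n (u p)) (w n p) = d (u p) p"
    using iso_group_dist[OF w] iso_group_mem[OF u p] p by blast
  moreover have "w n (u p) = g n (w n p)"
  proof -
    have "compose U (w n) u p = compose U (g n) (w n) p"
      using wu by (simp only: mult_iso_group[OF w u] mult_iso_group[OF g w])
    then show ?thesis using p by (simp add: compose_eq)
  qed
  moreover have "w n p = v n (f p)"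
    unfolding w_def using v f p by (simp add: mult_iso_group compose_eq)
  ultimately show False using far[of n] by simp
qed

section \<open>The isometry group of the separable Urysohn space\<close>

lemma urysohn_dense_sequence:
  assumes U: "urysohn_katetov natLeq U d"
  obtains q :: "nat \<Rightarrow> 'a" where "range q \<subseteq> U" "\<And>x c. x \<in> U \<Longrightarrow> c > 0 \<Longrightarrow> \<exists>i. d (q i) x < c"
proof -
  interpret Metric_space U d using U by (simp add: urysohn_katetov_def)
  obtain \<B> where B: "is_base mtopology \<B>" "|\<B>| =o natLeq"
    using U unfolding urysohn_katetov_def has_weight_def by blast
  have cB: "countable \<B>" using B(2) ordIso_imp_ordLeq countable_card_le_natLeq by blast
  obtain p where p: "p \<in> U"
    using urysohn_katetov_not_subset[OF U ordLeq_refl[OF natLeq_Card_order], of "{}"]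
      finite_iff_ordLess_natLeq by blast
  \<comment> \<open>One point from each nonempty member of a countable base; \<open>p\<close> makes
    \<open>Q\<close> nonempty, so that it can be enumerated.\<close>
  define Q where "Q = insert p ((\<lambda>V. SOME x. x \<in> V) ` (\<B> - {{}}))"
  have some: "(SOME x. x \<in> V) \<in> V" if "V \<noteq> {}" for V :: "'a set"
    using that some_in_eq by blast
  have QU: "Q \<subseteq> U"
  proof -
    have "V \<subseteq> U" if "V \<in> \<B>" for V
      using B(1) that openin_subset[of mtopology V] unfolding is_base_def by simp
    then show ?thesis using p some unfolding Q_def by blast
  qed
  have "countable Q" "Q \<noteq> {}" using cB by (auto simp: Q_def)
  then have q: "range (from_nat_into Q) = Q" by (rule range_from_nat_into[rotated])
  show thesis
  proof
    show "range (from_nat_into Q) \<subseteq> U" using q QU by simp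
    fix x and c :: real assume x: "x \<in> U" and c: "c > 0"
    have "openin mtopology (mball x c)" "x \<in> mball x c" using x c by auto
    then obtain V where V: "V \<in> \<B>" "x \<in> V" "V \<subseteq> mball x c"
      using B(1) unfolding is_base_def by blast
    have "(SOME y. y \<in> V) \<in> Q" using V by (auto simp: Q_def)
    moreover have "(SOME y. y \<in> V) \<in> mball x c" using V some by blast
    ultimately obtain i where "from_nat_into Q i \<in> mball x c" using q by (metis imageE)
    then show "\<exists>i. d (from_nat_into Q i) x < c" using commute by auto
  qed
qed

lemma urysohn_homogeneous_finite:
  assumes U: "urysohn_katetov natLeq U d" and A: "finite A" "A \<subseteq> U"
    and f: "\<And>x. x \<in> A \<Longrightarrow> f x \<in> U"
    and dist: "\<And>x y. x \<in> A \<Longrightarrow> y \<in> A \<Longrightarrow> d (f x) (f y) = d x y"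
  shows "\<exists>g\<in>carrier (iso_group U d). \<forall>x\<in>A. g x = f x"
proof -
  obtain g where g: "isometry_onto U d U d g" "\<And>x. x \<in> A \<Longrightarrow> g x = f x"
    using urysohn_katetov_homogeneous[OF U A(2) _ f dist] A(1) finite_iff_ordLess_natLeq by blast
  have "\<forall>x\<in>A. restrict g U x = f x" using g(2) A(2) by (simp add: subset_iff)
  with restrict_in_iso_group[OF g(1)] show ?thesis by blast
qed

lemma urysohn_extension_finite:
  assumes U: "urysohn_katetov natLeq U d" and Y: "finite Y" "Y \<subseteq> U"
    and "\<And>x. x \<in> Y \<Longrightarrow> 0 < f x"
    and "\<And>x y. x \<in> Y \<Longrightarrow> y \<in> Y \<Longrightarrow> f x \<le> f y + d x y"
    and "\<And>x y. x \<in> Y \<Longrightarrow> y \<in> Y \<Longrightarrow> d x y \<le> f x + f y"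
  shows "\<exists>z\<in>U. \<forall>y\<in>Y. d z y = f y"
proof -
  have "|Y| <o natLeq" using Y(1) finite_iff_ordLess_natLeq by blast
  then show ?thesis
    using katetov_extension[OF U ordLeq_refl[OF natLeq_Card_order] Y(2) countable_finite[OF Y(1)] _ assms(4-6)]
    by metis
qed

text \<open>Points \<open>y n\<close> are chosen with the same distances to \<open>A\<close> and
  \<open>p\<close> as a fixed \<open>z\<close>, so some \<open>v n\<close> moves \<open>z\<close> to
  \<open>y n\<close> and fixes \<open>A\<close>. A twin \<open>y' n\<close> at distance 1 has the
  same distances to \<open>F n\<close> as \<open>y n\<close>, so some \<open>g n\<close> moves
  \<open>y n\<close> to \<open>y' n\<close> and fixes \<open>F n\<close>.\<close>

lemma urysohn_criterion:
  assumes U: "urysohn_katetov natLeq U d" and p: "p \<in> U" and A: "finite A" "A \<subseteq> U"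
  shows "\<exists>f\<in>carrier (iso_group U d). \<exists>v g :: nat \<Rightarrow> _.
      (\<forall>n. v n \<in> carrier (iso_group U d) \<and> g n \<in> carrier (iso_group U d) \<and>
        (\<forall>a\<in>A. v n a = a) \<and> 1 \<le> d (g n (v n (f p))) (v n (f p))) \<and>
      (\<forall>x\<in>U. (\<lambda>n. d (g n x) x) \<longlonglongrightarrow> 0)"
proof -
  interpret Metric_space U d using U by (simp add: urysohn_katetov_def)
  define B where "B = insert p A"
  have B: "finite B" "B \<subseteq> U" "B \<noteq> {}" using A p by (auto simp: B_def)
  \<comment> \<open>A bound for the diameter of \<open>B\<close> makes the constant \<open>R\<close>
    a Katetov function on \<open>B\<close>; the inserted 1 leaves room for twins at distance
    1.\<close>
  define R where "R = Max (insert 1 ((\<lambda>(a, b). d a b) ` (B \<times> B)))"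
  have R1: "1 \<le> R" unfolding R_def using B(1) by (intro Max_ge) auto
  have RB: "d a b \<le> R" if "a \<in> B" "b \<in> B" for a b
    unfolding R_def using B(1) that by (intro Max_ge) auto
  \<comment> \<open>The Katetov extension of the constant \<open>R\<close> from \<open>B\<close> to
    the whole space; a single function then prescribes the distances for every
    \<open>F n\<close>.\<close>
  define \<phi> where "\<phi> z = R + Min ((\<lambda>a. d z a) ` B)" for z
  have min_le: "Min ((\<lambda>a. d z a) ` B) \<le> d z a" if "a \<in> B" for z a using B(1) that by simp
  have min_at: "\<exists>a\<in>B. \<phi> z = R + d z a" for z
    using Min_in[of "(\<lambda>a. d z a) ` B"] B unfolding \<phi>_def by fastforce
  have \<phi>R: "R \<le> \<phi> z" for z using min_at[of z] by auto
  have \<phi>pos: "0 < \<phi> z" for z using \<phi>R[of z] R1 by linarith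
  have \<phi>B: "\<phi> a = R" if "a \<in> B" for a
  proof -
    have "d a a = 0" using that B(2) by (simp add: subset_iff)
    then show ?thesis using min_le[OF that, of a] \<phi>R[of a] unfolding \<phi>_def by linarith
  qed
  have \<phi>lip: "\<phi> x \<le> \<phi> y + d x y" if xy: "x \<in> U" "y \<in> U" for x y
  proof -
    obtain a where a: "a \<in> B" "\<phi> y = R + d y a" using min_at by blast
    have "d x a \<le> d x y + d y a" using triangle xy a(1) B(2) by blast
    then show ?thesis using a min_le[OF a(1), of x] unfolding \<phi>_def[of x] by linarith
  qed
  have \<phi>tri: "d x y \<le> \<phi> x + \<phi> y" if xy: "x \<in> U" "y \<in> U" for x y
  proof -
    obtain a where a: "a \<in> B" "\<phi> x = R + d x a" using min_at by blast
    obtain b where b: "b \<in> B" "\<phi> y = R + d y b" using min_at by blast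
    have U': "a \<in> U" "b \<in> U" using a b B(2) by auto
    have "d x y \<le> d x a + d a y" "d a y \<le> d a b + d b y" using triangle xy U' by blast+
    then show ?thesis using RB[OF a(1) b(1)] a(2) b(2) R1 commute[of b y] by linarith
  qed
  obtain q :: "nat \<Rightarrow> 'a" where q: "range q \<subseteq> U" "\<And>x c. x \<in> U \<Longrightarrow> c > 0 \<Longrightarrow> \<exists>i. d (q i) x < c"
    using urysohn_dense_sequence[OF U] by blast
  \<comment> \<open>These sets exhaust the dense sequence, so isometries fixing \<open>F n\<close>
    converge pointwise to the identity.\<close>
  define F where "F n = B \<union> q ` {..n}" for n
  have F: "finite (F n)" "F n \<subseteq> U" for n using B q(1) by (auto simp: F_def)
  have "\<exists>y\<in>U. \<forall>x\<in>F n. d y x = \<phi> x" for n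
    using F[of n] \<phi>pos \<phi>lip \<phi>tri by (intro urysohn_extension_finite[OF U]) (auto simp: subset_iff)
  then obtain y where y: "\<And>n. y n \<in> U" "\<And>n x. x \<in> F n \<Longrightarrow> d (y n) x = \<phi> x" by metis
  have yF: "y n \<notin> F n" for n
  proof
    assume "y n \<in> F n"
    then have "\<phi> (y n) = 0" using y(2)[of "y n" n] y(1)[of n] by simp
    then show False using \<phi>pos[of "y n"] by simp
  qed
  have "\<exists>y'\<in>U. \<forall>x\<in>insert (y n) (F n). d y' x = (if x = y n then 1 else \<phi> x)" for n
  proof (rule urysohn_extension_finite[OF U])
    let ?f = "\<lambda>x. if x = y n then 1 else \<phi> x"
    show "finite (insert (y n) (F n))" "insert (y n) (F n) \<subseteq> U" using F[of n] y(1) by auto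
    show "0 < ?f x" for x using \<phi>pos by simp
    fix x x' assume x: "x \<in> insert (y n) (F n)" "x' \<in> insert (y n) (F n)"
    have FU: "z \<in> U" if "z \<in> F n" for z using that F[of n] by blast
    have *: "1 \<le> \<phi> z" for z using \<phi>R[of z] R1 by linarith
    show "?f x \<le> ?f x' + d x x'"
      using x yF[of n] \<phi>lip[OF FU FU, of x x'] y(2)[of x n] y(2)[of x' n] commute[of x "y n"] *[of x'] nonneg[of x x']
      by auto
    show "d x x' \<le> ?f x + ?f x'"
      using x yF[of n] \<phi>tri[OF FU FU, of x x'] y(2)[of x n] y(2)[of x' n] commute[of x "y n"] y(1)[of n]
      by auto
  qed
  then obtain y' where y': "\<And>n. y' n \<in> U" "\<And>n. d (y' n) (y n) = 1"
    "\<And>n x. x \<in> F n \<Longrightarrow> d (y' n) x = \<phi> x"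
    using yF by (metis insertCI)
  have "\<exists>z\<in>U. \<forall>a\<in>B. d z a = R"
    using B R1 RB by (intro urysohn_extension_finite[OF U]) (auto intro: order_trans[OF RB])
  then obtain z where z: "z \<in> U" "\<And>a. a \<in> B \<Longrightarrow> d z a = R" by blast
  have zB: "z \<notin> B" using z(2)[of z] z(1) R1 by auto
  \<comment> \<open>One \<open>f\<close>, chosen independently of \<open>n\<close>, brings
    \<open>p\<close> to the position from which the \<open>v n\<close> act.\<close>
  obtain f where f: "f \<in> carrier (iso_group U d)" "f p = z"
    using urysohn_homogeneous_finite[OF U, of "{p}" "\<lambda>_. z"] p z(1) by auto
  have "\<exists>v\<in>carrier (iso_group U d). \<forall>x\<in>insert z B. v x = (if x = z then y n else x)" for n
  proof (rule urysohn_homogeneous_finite[OF U])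
    have BF: "d (y n) a = R" if "a \<in> B" for a using y(2)[of a n] \<phi>B[OF that] that by (simp add: F_def)
    show "finite (insert z B)" "insert z B \<subseteq> U" using B z by auto
    show "(if x = z then y n else x) \<in> U" if "x \<in> insert z B" for x using that B y(1) by auto
    show "d (if x = z then y n else x) (if x' = z then y n else x') = d x x'"
      if "x \<in> insert z B" "x' \<in> insert z B" for x x'
      using that BF z zB y(1)[of n] commute[of x "y n"] commute[of x z] by auto
  qed
  then obtain v where v: "\<And>n. v n \<in> carrier (iso_group U d)" "\<And>n. v n z = y n"
    "\<And>n a. a \<in> B \<Longrightarrow> v n a = a"
    using zB by (metis insertCI)
  have "\<exists>g\<in>carrier (iso_group U d). \<forall>x\<in>insert (y n) (F n). g x = (if x = y n then y' n else x)" for n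
  proof (rule urysohn_homogeneous_finite[OF U])
    show "finite (insert (y n) (F n))" "insert (y n) (F n) \<subseteq> U" using F[of n] y(1) by auto
    show "(if x = y n then y' n else x) \<in> U" if "x \<in> insert (y n) (F n)" for x
      using that F[of n] y'(1) by auto
    show "d (if x = y n then y' n else x) (if x' = y n then y' n else x') = d x x'"
      if "x \<in> insert (y n) (F n)" "x' \<in> insert (y n) (F n)" for x x'
      using that y(1)[of n] y'(1)[of n] y(2)[of x n] y(2)[of x' n] y'(3)[of x n] y'(3)[of x' n]
        commute[of x "y n"] commute[of x "y' n"] by auto
  qed
  then obtain g where g: "\<And>n. g n \<in> carrier (iso_group U d)" "\<And>n. g n (y n) = y' n"
    "\<And>n x. x \<in> F n \<Longrightarrow> g n x = x"
    using yF by (metis insertCI)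
  have "(\<lambda>n. d (g n x) x) \<longlonglongrightarrow> 0" if x: "x \<in> U" for x
  proof (rule LIMSEQ_I)
    fix c :: real assume "c > 0"
    then obtain i where i: "d (q i) x < c / 2" using q(2)[OF x, of "c/2"] by auto
    have "norm (d (g n x) x - 0) < c" if "n \<ge> i" for n
    proof -
      have qF: "q i \<in> F n" and qU: "q i \<in> U" using that q(1) by (auto simp: F_def)
      have "d (g n x) x \<le> d (g n x) (g n (q i)) + d (g n (q i)) x"
        using triangle iso_group_mem[OF g(1)] x qU by blast
      also have "\<dots> = d x (q i) + d (q i) x"
        using iso_group_dist[OF g(1) x qU, of n] g(3)[OF qF] by simp
      finally show ?thesis using i commute[of x "q i"] by simp
    qed
    then show "\<exists>no. \<forall>n\<ge>no. norm (d (g n x) x - 0) < c" by blast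
  qed
  moreover have "1 \<le> d (g n (v n (f p))) (v n (f p))" for n
    using y'(2) g(2) v(2) f(2) by simp
  moreover have "\<forall>a\<in>A. v n a = a" for n using v(3) by (simp add: B_def)
  ultimately show ?thesis using f(1) v(1) g(1) by blast
qed

section \<open>The permutation group of the natural numbers\<close>

abbreviation nat_dd :: "nat \<Rightarrow> nat \<Rightarrow> real" where
  "nat_dd \<equiv> discrete_metric.dd"

lemma permutation_in_iso_group_nat:
  "bij \<pi> \<Longrightarrow> \<pi> \<in> carrier (iso_group (UNIV :: nat set) nat_dd)"
  by (simp add: carrier_iso_group isometry_onto_def discrete_metric.dd_def bij_is_inj inj_eq)

lemma permutation_criterion:
  assumes "finite (A :: nat set)"
  shows "\<exists>f\<in>carrier (iso_group UNIV nat_dd). \<exists>v g :: nat \<Rightarrow> _.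
      (\<forall>n. v n \<in> carrier (iso_group UNIV nat_dd) \<and> g n \<in> carrier (iso_group UNIV nat_dd) \<and>
        (\<forall>a\<in>A. v n a = a) \<and> 1 \<le> nat_dd (g n (v n (f 0))) (v n (f 0))) \<and>
      (\<forall>x\<in>UNIV. (\<lambda>n. nat_dd (g n x) x) \<longlonglongrightarrow> 0)"
proof -
  obtain N where N: "\<And>a. a \<in> A \<Longrightarrow> a < N"
    using assms unfolding finite_nat_set_iff_bounded by blast
  \<comment> \<open>All of \<open>A\<close> lies below \<open>N\<close>: \<open>?f\<close> takes 0
    to \<open>N\<close>, \<open>?v n\<close> takes \<open>N\<close> to \<open>N + n\<close> without
    touching \<open>A\<close>, and \<open>?g n\<close> moves that point while fixing everything
    below it.\<close>
  let ?f = "Transposition.transpose 0 N" and ?v = "\<lambda>n. Transposition.transpose N (N + n)"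
  let ?g = "\<lambda>n. Transposition.transpose (N + n) (Suc (N + n))"
  have "(\<lambda>n. nat_dd (?g n x) x) \<longlonglongrightarrow> 0" for x
  proof (rule tendsto_eventually)
    have "nat_dd (?g n x) x = 0" if "n > x" for n
      using that by (simp add: discrete_metric.dd_def transpose_apply_other)
    then show "\<forall>\<^sub>F n in sequentially. nat_dd (?g n x) x = 0"
      using eventually_gt_at_top[of x] by (rule eventually_mono[rotated])
  qed
  moreover have "?v n a = a" if "a \<in> A" for n a
    using N[OF that] by (simp add: transpose_apply_other)
  moreover have "1 \<le> nat_dd (?g n (?v n (?f 0))) (?v n (?f 0))" for n
    by (simp add: discrete_metric.dd_def)
  moreover have "Transposition.transpose a b \<in> carrier (iso_group UNIV nat_dd)" for a b :: nat
    by (simp add: permutation_in_iso_group_nat)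
  ultimately show ?thesis
    by (intro bexI[of _ ?f] exI[of _ ?v] exI[of _ ?g]) auto
qed

text \<open>The permutation group is a subspace of the Baire space of sequences of natural
  numbers.\<close>

lemma second_countable_iso_topology_nat:
  "second_countable (iso_topology (UNIV :: nat set) nat_dd)"
proof -
  have "Metric_space.mtopology (UNIV :: nat set) nat_dd = euclidean"
    by (metis discrete_metric.mtopology_discrete_metric discrete_topology_unique open_discrete
        open_openin topspace_euclidean)
  then have "product_topology (\<lambda>_. Metric_space.mtopology (UNIV :: nat set) nat_dd) (UNIV :: nat set) = euclidean"
    by (simp add: euclidean_product_topology)
  moreover have "second_countable (euclidean :: (nat \<Rightarrow> nat) topology)"
  proof -
    obtain \<B> :: "(nat \<Rightarrow> nat) set set" where "countable \<B>" "topological_basis \<B>"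
      using ex_countable_basis by blast
    then show ?thesis
      unfolding second_countable_def
      by (metis open_openin topological_basisE topological_basis_open)
  qed
  ultimately show ?thesis unfolding iso_topology_def by (simp add: second_countable_subtopology)
qed

text \<open>A function is coded by its graph, with pairs sent into the infinite type
  \<open>'c\<close>. This places the permutation group on the type over which universality is
  formulated.\<close>

lemma inj_functions_into_sets:
  assumes "natLeq <o (m :: 'c rel)"
  obtains \<phi> :: "(nat \<Rightarrow> nat) \<Rightarrow> 'c set" where "inj \<phi>"
proof -
  have "cinfinite m"
    using cinfinite_mono[OF ordLess_imp_ordLeq[OF assms] natLeq_cinfinite] .
  then have "infinite (UNIV :: 'c set)"
    unfolding cinfinite_def using finite_subset[OF subset_UNIV] by blast
  then obtain \<iota> :: "nat \<Rightarrow> 'c" where \<iota>: "inj \<iota>"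
    unfolding infinite_iff_countable_subset by blast
  define \<phi> :: "(nat \<Rightarrow> nat) \<Rightarrow> 'c set" where "\<phi> f = range (\<lambda>n. \<iota> (prod_encode (n, f n)))" for f
  have "f n = f' n" if "\<phi> f = \<phi> f'" for f f' n
  proof -
    have "\<iota> (prod_encode (n, f n)) \<in> \<phi> f" unfolding \<phi>_def by blast
    then have "\<iota> (prod_encode (n, f n)) \<in> \<phi> f'" using that by simp
    then show ?thesis using \<iota> by (auto simp: \<phi>_def inj_eq prod_encode_eq)
  qed
  then have "inj \<phi>" by (auto intro!: injI)
  then show thesis using that by blast
qed

theorem mainTheorem3:
  fixes m :: "'c rel"
    and Um :: "'a set" and dm :: "'a \<Rightarrow> 'a \<Rightarrow> real"
  assumes "Card_order m"
    and "natLeq <o m"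
    and "is_cardinal_sup {m ^c n | n :: 'c rel. Card_order n \<and> n <o m} m"
    and "urysohn_katetov m Um dm"
  shows "(\<forall>(U :: 'u set) d. urysohn_katetov natLeq U d \<longrightarrow>
            \<not> embeds_as_topological_subgroup (iso_group U d) (iso_topology U d)
                (iso_group Um dm) (iso_topology Um dm)) \<and>
         \<not> contains_all_groups_of_weight_le m (iso_group Um dm) (iso_topology Um dm)"
proof (intro conjI allI impI)
  fix U :: "'u set" and d assume U: "urysohn_katetov natLeq U d"
  obtain q :: "nat \<Rightarrow> 'u" where "range q \<subseteq> U"
    using urysohn_dense_sequence[OF U] .
  then have p: "q 0 \<in> U" by blast
  show "\<not> embeds_as_topological_subgroup (iso_group U d) (iso_topology U d)
      (iso_group Um dm) (iso_topology Um dm)"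
  proof (rule not_embeds_iso_group[OF _ assms(4,2) p zero_less_one])
    show "Metric_space U d" using U by (simp add: urysohn_katetov_def)
  qed (rule urysohn_criterion[OF U p])
next
  let ?G = "iso_group (UNIV :: nat set) nat_dd" and ?S = "iso_topology (UNIV :: nat set) nat_dd"
  let ?H = "iso_group Um dm" and ?T = "iso_topology Um dm"
  \<comment> \<open>The permutation group is available outright, whereas in the first claim the
    separable Urysohn space is only a given \<open>U\<close>.\<close>
  have not: "\<not> embeds_as_topological_subgroup ?G ?S ?H ?T"
    by (rule not_embeds_iso_group[OF metric_M_dd assms(4,2) UNIV_I zero_less_one])
      (rule permutation_criterion)
  obtain \<phi> :: "(nat \<Rightarrow> nat) \<Rightarrow> 'c set" where "inj \<phi>"
    using inj_functions_into_sets[OF assms(2)] .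
  then obtain G' :: "'c set monoid" and S' where G': "topological_group G' S'" "\<phi> \<in> iso ?G G'"
    and hom: "homeomorphic_map ?S S' \<phi>"
    using topological_group_transport[OF topological_group_iso_group[OF metric_M_dd]]
    by (metis inj_on_subset subset_UNIV)
  have space: "?S homeomorphic_space S'" using hom by (rule homeomorphic_map_imp_homeomorphic_space)
  then have "Hausdorff_space S'"
    using Hausdorff_space_iso_topology[OF metric_M_dd] homeomorphic_Hausdorff_space by blast
  moreover have "weight_le S' m"
  proof -
    have "second_countable S'"
      using space second_countable_iso_topology_nat homeomorphic_space_second_countability by blast
    then obtain \<B> where "countable \<B>" "is_base S' \<B>"
      unfolding second_countable_def is_base_def by blast
    then show ?thesis
      unfolding weight_le_def
      using countable_imp_card_less[OF assms(2)] ordLess_imp_ordLeq by blast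
  qed
  moreover have "\<not> embeds_as_topological_subgroup G' S' ?H ?T"
  \<comment> \<open>An embedding of the copy \<open>G'\<close>, composed with \<open>\<phi>\<close>,
    would embed the permutation group.\<close>
  proof
    assume "embeds_as_topological_subgroup G' S' ?H ?T"
    then obtain K h where "subgroup K ?H" "h \<in> iso G' (?H\<lparr>carrier := K\<rparr>)"
      "homeomorphic_map S' (subtopology ?T K) h"
      unfolding embeds_as_topological_subgroup_def by blast
    then have "embeds_as_topological_subgroup ?G ?S ?H ?T"
      unfolding embeds_as_topological_subgroup_def
      using iso_set_trans[OF G'(2)] homeomorphic_map_compose[OF hom] by blast
    with not show False by simp
  qed
  ultimately show "\<not> contains_all_groups_of_weight_le m ?H ?T"
    using G'(1) unfolding contains_all_groups_of_weight_le_def by blast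
qed

end
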